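(* Let $U$ and $O$ be finite sets of users and objects, $E\subseteq U\times O$ with every user incident to at least one edge and every object incident to at least one edge, $w_{ij}\in[0,1]$ for each $(i,j)\in E$, and $\alpha\in(0,1)$. Let $(b^t)_{t\ge 0}$ be the sequence of bias vectors produced by the iterative debiasing algorithm (defined in the context) from an arbitrary initial vector $b^0\in[-1,1]^U$. For every real $\epsilon>0$, put $t=\log_{1/\alpha}\!\left(\frac{2}{\epsilon}\right)$. Then for all nonnegative integers $m,n>t$ and every user $i\in U$, $$|b_i^m-b_i^n|\le\epsilon .$$ Consequently, for every $i\in U$ the sequence $(b_i^t)_{t\ge 0}$ is a Cauchy sequence and converges.
   Context: For a user $i\in U$ let $d_i^+=\{j\in O:(i,j)\in E\}$ be the set of objects rated by $i$, and for an object $j\in O$ let $d_j^-=\{i\in U:(i,j)\in E\}$ be the set of users rating $j$. The number $w_{ij}$ is the rating given by user $i$ to object $j$. Iterative debiasing algorithm: starting from an initial bias vector $b^0=(b_i^0)_{i\in U}\in[-1,1]^U$, for each integer $t\ge 0$ define $$r_j^{t+1}=\frac{1}{|d_j^-|}\sum_{k\in d_j^-}\max\{0,\min\{1,w_{kj}-\alpha b_k^t\}\}\quad (j\in O),$$ $$b_i^{t+1}=\frac{1}{|d_i^+|}\sum_{j\in d_i^+}\bigl(w_{ij}-r_j^{t+1}\bigr)\quad (i\in U).$$ Here $r_j^t$ is the true rating of object $j$ and $b_i^t$ is the bias of user $i$ after $t$ iterations. *)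

theory Defs
  imports Complex_Main
begin

text \<open>Users, objects and ratings: \<open>(i, j) \<in> E\<close> means that user \<open>i\<close> rates object \<open>j\<close>, with
  rating \<open>w i j\<close>. The set of objects is called \<open>Obj\<close> because \<open>O\<close> is the infix relation
  composition. Below, \<open>d_out\<close> is $d_i^+$ and \<open>d_in\<close> is $d_j^-$.\<close>

definition d_out :: "'o set \<Rightarrow> ('u \<times> 'o) set \<Rightarrow> 'u \<Rightarrow> 'o set" where
  "d_out Obj E i = {j \<in> Obj. (i, j) \<in> E}"

definition d_in :: "'u set \<Rightarrow> ('u \<times> 'o) set \<Rightarrow> 'o \<Rightarrow> 'u set" where
  "d_in U E j = {i \<in> U. (i, j) \<in> E}"

text \<open>\<open>rating_update U E w \<alpha> b\<close> is $r^{t+1}$ if \<open>b\<close> is $b^t$, and \<open>bias_update Obj E w r\<close> is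
  $b^{t+1}$ if \<open>r\<close> is $r^{t+1}$. Only the values on \<open>Obj\<close> and \<open>U\<close>, respectively, are meaningful.\<close>

definition rating_update ::
  "'u set \<Rightarrow> ('u \<times> 'o) set \<Rightarrow> ('u \<Rightarrow> 'o \<Rightarrow> real) \<Rightarrow> real \<Rightarrow> ('u \<Rightarrow> real) \<Rightarrow> 'o \<Rightarrow> real" where
  "rating_update U E w \<alpha> b j =
     1 / real (card (d_in U E j)) * (\<Sum>k\<in>d_in U E j. max 0 (min 1 (w k j - \<alpha> * b k)))"

definition bias_update ::
  "'o set \<Rightarrow> ('u \<times> 'o) set \<Rightarrow> ('u \<Rightarrow> 'o \<Rightarrow> real) \<Rightarrow> ('o \<Rightarrow> real) \<Rightarrow> 'u \<Rightarrow> real" where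
  "bias_update Obj E w r i =
     1 / real (card (d_out Obj E i)) * (\<Sum>j\<in>d_out Obj E i. w i j - r j)"

primrec bias ::
  "'u set \<Rightarrow> 'o set \<Rightarrow> ('u \<times> 'o) set \<Rightarrow> ('u \<Rightarrow> 'o \<Rightarrow> real) \<Rightarrow> real \<Rightarrow> ('u \<Rightarrow> real) \<Rightarrow>
   nat \<Rightarrow> 'u \<Rightarrow> real" where
  "bias U Obj E w \<alpha> b0 0 = b0"
| "bias U Obj E w \<alpha> b0 (Suc t) =
     bias_update Obj E w (rating_update U E w \<alpha> (bias U Obj E w \<alpha> b0 t))"

end

(* One step of the iteration maps [-1,1]^U into itself and contracts the maximum norm by the
   factor \<alpha>, because clamping to [0,1] is 1-Lipschitz and averaging is nonexpansive. Hence
   b^(k+p) and b^k, being the k-th iterates of b^p and b^0, differ by at most 2 \<alpha>^k. *)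
theory Submission
  imports Defs
begin

(* For empty or infinite S the average is 0, because x / 0 = 0. *)
lemma abs_mean_le:
  fixes f :: "'a \<Rightarrow> real"
  assumes "\<And>x. x \<in> S \<Longrightarrow> \<bar>f x\<bar> \<le> c" and "0 \<le> c"
  shows "\<bar>1 / real (card S) * sum f S\<bar> \<le> c"
proof (cases "card S = 0")
  case False
  have "\<bar>sum f S\<bar> \<le> (\<Sum>x\<in>S. \<bar>f x\<bar>)"
    by (rule sum_abs)
  also have "\<dots> \<le> real (card S) * c"
    using assms(1) by (rule sum_bounded_above)
  finally show ?thesis
    using False by (simp add: abs_mult divide_le_eq mult.commute)
qed (use assms(2) in simp)

lemma abs_mean_diff_le:
  fixes f g :: "'a \<Rightarrow> real"
  assumes "\<And>x. x \<in> S \<Longrightarrow> \<bar>f x - g x\<bar> \<le> c" and "0 \<le> c"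
  shows "\<bar>1 / real (card S) * sum f S - 1 / real (card S) * sum g S\<bar> \<le> c"
  using abs_mean_le[of S "\<lambda>x. f x - g x" c] assms
  by (simp add: sum_subtractf right_diff_distrib diff_divide_distrib)

text \<open>The clamp puts every summand in [0,1], whatever \<open>b\<close> is. An object without
  raters gets the value 0, which also lies in this interval, so \<open>j\<close> can be
  arbitrary.\<close>

lemma rating_update_range: "rating_update U E w \<alpha> b j \<in> {0..1}"
proof -
  have "\<bar>rating_update U E w \<alpha> b j\<bar> \<le> 1"
    unfolding rating_update_def by (rule abs_mean_le) auto
  moreover have "0 \<le> rating_update U E w \<alpha> b j"
    unfolding rating_update_def by (intro mult_nonneg_nonneg sum_nonneg) auto
  ultimately show ?thesis
    by simp
qed

lemma abs_rating_update_diff_le: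
  assumes "\<And>k. k \<in> U \<Longrightarrow> \<bar>b k - b' k\<bar> \<le> c" and "0 \<le> \<alpha>" and "0 \<le> c"
  shows "\<bar>rating_update U E w \<alpha> b j - rating_update U E w \<alpha> b' j\<bar> \<le> \<alpha> * c"
  unfolding rating_update_def
proof (rule abs_mean_diff_le)
  fix k
  assume "k \<in> d_in U E j"
  then have "\<bar>b k - b' k\<bar> \<le> c"
    using assms(1) by (simp add: d_in_def)
  then have "\<bar>\<alpha> * b k - \<alpha> * b' k\<bar> \<le> \<alpha> * c"
    using \<open>0 \<le> \<alpha>\<close> by (simp add: abs_mult mult_left_mono flip: right_diff_distrib)
  \<comment> \<open>Clamping to [0,1] does not increase distances, and \<open>w k j\<close> cancels;
    \<open>linarith\<close> checks this by splitting \<open>max\<close> and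
    \<open>min\<close>.\<close>
  then show "\<bar>max 0 (min 1 (w k j - \<alpha> * b k)) - max 0 (min 1 (w k j - \<alpha> * b' k))\<bar> \<le> \<alpha> * c"
    by linarith
qed (use assms in simp)

text \<open>The ratings \<open>w i j\<close> cancel in the difference, which leaves an average of
  \<open>r' j - r j\<close>. The factor \<alpha> thus comes from the rating update alone.\<close>

lemma abs_bias_update_diff_le:
  assumes "\<And>j. \<bar>r j - r' j\<bar> \<le> c" and "0 \<le> c"
  shows "\<bar>bias_update Obj E w r i - bias_update Obj E w r' i\<bar> \<le> c"
  unfolding bias_update_def
  by (rule abs_mean_diff_le) (use assms in \<open>simp_all add: abs_minus_commute\<close>)

lemma abs_bias_update_le:
  assumes "\<And>j. (i, j) \<in> E \<Longrightarrow> w i j \<in> {0..1}" and "\<And>j. r j \<in> {0..1}"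
  shows "\<bar>bias_update Obj E w r i\<bar> \<le> 1"
  unfolding bias_update_def
proof (rule abs_mean_le)
  fix j
  assume "j \<in> d_out Obj E i"
  then show "\<bar>w i j - r j\<bar> \<le> 1"
    using assms(1)[of j] assms(2)[of j] by (auto simp: d_out_def)
qed simp

lemma abs_bias_le:
  assumes "\<forall>(i, j)\<in>E. w i j \<in> {0..1}" and "\<forall>i\<in>U. b0 i \<in> {-1..1}" and "i \<in> U"
  shows "\<bar>bias U Obj E w \<alpha> b0 t i\<bar> \<le> 1"
proof (cases t)
  case 0
  with assms show ?thesis
    by force
next
  case (Suc s)
  then show ?thesis
    \<comment> \<open>Interval membership is kept folded so that the goals match the two facts
      directly.\<close>
    using assms(1) rating_update_range by (auto intro!: abs_bias_update_le simp del: atLeastAtMost_iff)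
qed

text \<open>Induction on \<open>k\<close> with the shift \<open>p\<close> fixed. The constant 2 is
  the largest distance between two points of [-1,1], and each step contributes a factor \<alpha>.
  The user is generalized because one update of a single bias involves the biases of other
  users.\<close>

lemma abs_bias_shift_diff_le:
  assumes "\<forall>(i, j)\<in>E. w i j \<in> {0..1}" and "\<forall>i\<in>U. b0 i \<in> {-1..1}" and "0 \<le> \<alpha>" and "i \<in> U"
  shows "\<bar>bias U Obj E w \<alpha> b0 (k + p) i - bias U Obj E w \<alpha> b0 k i\<bar> \<le> 2 * \<alpha> ^ k"
  using \<open>i \<in> U\<close>
proof (induction k arbitrary: i)
  case 0
  then show ?case
    using abs_bias_le[OF assms(1,2), of i Obj \<alpha> p] abs_bias_le[OF assms(1,2), of i Obj \<alpha> 0]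
    unfolding power_0 add_0 by linarith
next
  case (Suc k)
  have "\<bar>bias U Obj E w \<alpha> b0 (Suc k + p) i - bias U Obj E w \<alpha> b0 (Suc k) i\<bar> \<le> \<alpha> * (2 * \<alpha> ^ k)"
    unfolding add_Suc bias.simps
    by (intro abs_bias_update_diff_le abs_rating_update_diff_le Suc.IH)
      (use \<open>0 \<le> \<alpha>\<close> in simp_all)
  then show ?case
    by (simp add: mult.left_commute)
qed

lemma two_power_le:
  assumes "0 < \<alpha>" and "\<alpha> < 1" and "0 < \<epsilon>" and "log (1 / \<alpha>) (2 / \<epsilon>) < real k"
  shows "2 * \<alpha> ^ k \<le> \<epsilon>"
proof -
  \<comment> \<open>The base \<open>1 / \<alpha>\<close> exceeds 1, so exponentiating preserves the
    strict inequality.\<close>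
  have "2 / \<epsilon> < (1 / \<alpha>) powr real k"
    using assms by (subst (asm) log_less_iff) auto
  also have "\<dots> = 1 / \<alpha> ^ k"
    using assms by (simp add: powr_realpow power_one_over)
  finally show ?thesis
    using assms by (simp add: field_simps)
qed

theorem mainTheorem3:
  fixes U :: "'u set" and Obj :: "'o set" and E :: "('u \<times> 'o) set"
    and w :: "'u \<Rightarrow> 'o \<Rightarrow> real" and \<alpha> :: real and b0 :: "'u \<Rightarrow> real"
  assumes "finite U" and "finite Obj" and "E \<subseteq> U \<times> Obj"
    and "\<forall>i\<in>U. \<exists>j\<in>Obj. (i, j) \<in> E"
    and "\<forall>j\<in>Obj. \<exists>i\<in>U. (i, j) \<in> E"
    and "\<forall>(i, j)\<in>E. w i j \<in> {0..1}"
    and "\<alpha> \<in> {0<..<1}"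
    and "\<forall>i\<in>U. b0 i \<in> {-1..1}"
  shows "(\<forall>\<epsilon>>0. let t = log (1 / \<alpha>) (2 / \<epsilon>) in
            \<forall>m n. real m > t \<and> real n > t \<longrightarrow>
              (\<forall>i\<in>U. \<bar>bias U Obj E w \<alpha> b0 m i - bias U Obj E w \<alpha> b0 n i\<bar> \<le> \<epsilon>))
         \<and> (\<forall>i\<in>U. Cauchy (\<lambda>t. bias U Obj E w \<alpha> b0 t i) \<and>
                   convergent (\<lambda>t. bias U Obj E w \<alpha> b0 t i))"
proof -
  let ?b = "bias U Obj E w \<alpha> b0"
  have \<alpha>: "0 < \<alpha>" "\<alpha> < 1"
    using assms(7) by auto
  have le_eps: "\<bar>?b m i - ?b n i\<bar> \<le> \<epsilon>"
    if "0 < \<epsilon>" "log (1 / \<alpha>) (2 / \<epsilon>) < real m" "log (1 / \<alpha>) (2 / \<epsilon>) < real n" "i \<in> U" for \<epsilon> m n i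
    using that(2,3)
  \<comment> \<open>The claim is symmetric, so let \<open>m \<le> n\<close> and apply the shift
    bound with \<open>p = n - m\<close>; the smaller index gives the exponent.\<close>
  proof (induction m n rule: linorder_wlog)
    case (le m n)
    then have "\<bar>?b n i - ?b m i\<bar> \<le> 2 * \<alpha> ^ m"
      using abs_bias_shift_diff_le[OF assms(6,8), of \<alpha> i Obj m "n - m"] \<alpha> \<open>i \<in> U\<close> by simp
    also have "\<dots> \<le> \<epsilon>"
      using \<alpha> \<open>0 < \<epsilon>\<close> le by (intro two_power_le)
    finally show ?case
      by (simp add: abs_minus_commute)
  next
    case (sym m n)
    then show ?case
      by (simp add: abs_minus_commute)
  qed
  have Cauchy: "Cauchy (\<lambda>t. ?b t i)" if "i \<in> U" for i
  proof (rule metric_CauchyI)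
    fix e :: real
    assume "0 < e"
    \<comment> \<open>Halving \<open>e\<close> turns the non-strict bound of \<open>le_eps\<close>
      into the strict one required here.\<close>
    obtain N where N: "log (1 / \<alpha>) (2 / (e / 2)) < real N"
      using reals_Archimedean2 by blast
    have "dist (?b m i) (?b n i) < e" if "N \<le> m" "N \<le> n" for m n
    proof -
      have "\<bar>?b m i - ?b n i\<bar> \<le> e / 2"
        using N that \<open>0 < e\<close> \<open>i \<in> U\<close> by (intro le_eps) (auto intro: less_le_trans)
      with \<open>0 < e\<close> show ?thesis
        by (simp add: dist_real_def)
    qed
    then show "\<exists>M. \<forall>m\<ge>M. \<forall>n\<ge>M. dist (?b m i) (?b n i) < e"
      by blast
  qed
  show ?thesis
    using le_eps Cauchy by (auto simp: Let_def Cauchy_convergent)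
qed

end
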